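(* Let $a,b,m\in\mathbb{Z}$ with $a\ge 2$, $m>1$, $\gcd(b,m)=1$, and $b\ge -(a-2)m-2$, and let $S=S_{a,b}(m)$ and $d=(a-1)m+b$. Let $n$ be the smallest positive integer such that $A_n\ge m$, let $A=\{A_1,\ldots,A_{n-1}\}$, and for $0\le\ell\le m-1$ set $W(\ell)=d\ell+\mathsf{m}_A(\ell)m$. Let $\ell\in\{0,\ldots,m-1\}$. If $W(\ell)\in\operatorname{Maximals}_{\preceq_S}(\operatorname{Ap}(S))$, then $u_{n-1}^{(\ell)}\in\{u_{n-1}^{(m-1)}-1,\,u_{n-1}^{(m-1)}\}$. Equivalently, if $u_{n-1}^{(\ell)}\le u_{n-1}^{(m-1)}-2$, then $W(\ell)$ is not maximal in $\operatorname{Ap}(S)$ with respect to $\preceq_S$.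
   Context: $\mathbb{N}=\{0,1,2,\dots\}$. Let $T_{a,b}(z)=az+b$, with $T_{a,b}^i$ its $i$-fold composition ($T_{a,b}^0$ the identity), and let $S_{a,b}(m)=\langle T_{a,b}^i(m)\mid i\ge 0\rangle$ be the submonoid of $(\mathbb{N},+)$ generated by the orbit of $m$; under the stated hypotheses it is a numerical semigroup (finite complement in $\mathbb{N}$) whose smallest positive element is $m$. Set $A_i=(a^i-1)/(a-1)$ for $i\ge 0$ (so $A_1=1$); since $m>1$, $n\ge 2$. The Apéry set is $\operatorname{Ap}(S)=\{s\in S\mid s-m\notin S\}$; under the stated hypotheses $\operatorname{Ap}(S)=\{W(0),\ldots,W(m-1)\}$. The order $\preceq_S$ is $x\preceq_S y$ iff $y-x\in S$, and $\operatorname{Maximals}_{\preceq_S}(\operatorname{Ap}(S))$ is the set of maximal elements of $\operatorname{Ap}(S)$ for $\preceq_S$. $\mathsf{m}_A(x)$ is the minimum of $\sum_{i=1}^{n-1}u_i$ over all $(u_1,\ldots,u_{n-1})\in\mathbb{N}^{n-1}$ with $x=\sum_{i=1}^{n-1}u_iA_i$. $R(a,n)$ is the set of $\mathbf{u}=(u_1,\ldots,u_{n-1})\in\mathbb{N}^{n-1}$ such that $0\le u_j\le a$ for all $j$, and if $u_j=a$ then $u_k=0$ for every $k<j$. For each integer $0\le\ell<A_n$ there is a unique $\mathbf{u}^{(\ell)}=(u^{(\ell)}_1,\ldots,u^{(\ell)}_{n-1})\in R(a,n)$ with $\ell=\sum_{i=1}^{n-1}u^{(\ell)}_iA_i$,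 called the canonical representative of $\ell$. *)

theory Defs
  imports "HOL-Library.FuncSet"
begin

definition T_ab :: "int \<Rightarrow> int \<Rightarrow> int \<Rightarrow> int" where
  "T_ab a b z = a * z + b"

inductive_set submonoid_gen :: "'a::monoid_add set \<Rightarrow> 'a set" for X where
  zero: "0 \<in> submonoid_gen X"
| gen: "x \<in> X \<Longrightarrow> x \<in> submonoid_gen X"
| add: "x \<in> submonoid_gen X \<Longrightarrow> y \<in> submonoid_gen X \<Longrightarrow> x + y \<in> submonoid_gen X"

text \<open>
  The semigroup is a set of integers, so that differences such as \<open>s - m\<close> and \<open>y - x\<close>
  are not truncated. Whenever the orbit of \<open>m\<close> consists of natural numbers, this is the
  submonoid of the natural numbers generated by the orbit.
\<close>

definition S_ab :: "int \<Rightarrow> int \<Rightarrow> int \<Rightarrow> int set" where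
  "S_ab a b m = submonoid_gen {(T_ab a b ^^ i) m | i. True}"

definition Ap :: "int set \<Rightarrow> int \<Rightarrow> int set" where
  "Ap S m = {s \<in> S. s - m \<notin> S}"

definition preceq :: "int set \<Rightarrow> int \<Rightarrow> int \<Rightarrow> bool" where
  "preceq S x y \<longleftrightarrow> y - x \<in> S"

definition Maximals :: "('a \<Rightarrow> 'a \<Rightarrow> bool) \<Rightarrow> 'a set \<Rightarrow> 'a set" where
  "Maximals le X = {x \<in> X. \<forall>y\<in>X. le x y \<longrightarrow> y = x}"

text \<open>The division is exact for \<open>a \<noteq> 1\<close>.\<close>

definition A_seq :: "int \<Rightarrow> nat \<Rightarrow> int" where
  "A_seq a i = (a ^ i - 1) div (a - 1)"

text \<open>
  Tuples \<open>(u\<^sub>1, \<dots>, u\<^sub>n\<^sub>-\<^sub>1)\<close> of natural numbers are extensional functions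
  on \<open>{1..n-1}\<close>, so that distinct functions represent distinct tuples.
\<close>

definition tuples :: "nat \<Rightarrow> (nat \<Rightarrow> nat) set" where
  "tuples n = {1..n-1} \<rightarrow>\<^sub>E UNIV"

definition A_sum :: "int \<Rightarrow> nat \<Rightarrow> (nat \<Rightarrow> nat) \<Rightarrow> int" where
  "A_sum a n u = (\<Sum>i=1..n-1. int (u i) * A_seq a i)"

definition m_A :: "int \<Rightarrow> nat \<Rightarrow> int \<Rightarrow> nat" where
  "m_A a n x = (LEAST k. \<exists>u\<in>tuples n. x = A_sum a n u \<and> k = (\<Sum>i=1..n-1. u i))"

definition R_set :: "int \<Rightarrow> nat \<Rightarrow> (nat \<Rightarrow> nat) set" where
  "R_set a n = {u \<in> tuples n. \<forall>j\<in>{1..n-1}. int (u j) \<le> a \<and>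
      (int (u j) = a \<longrightarrow> (\<forall>k\<in>{1..n-1}. k < j \<longrightarrow> u k = 0))}"

text \<open>The description is proper only for \<open>0 \<le> l < A_seq a n\<close>.\<close>

definition canonical_rep :: "int \<Rightarrow> nat \<Rightarrow> int \<Rightarrow> nat \<Rightarrow> nat" where
  "canonical_rep a n l = (THE u. u \<in> R_set a n \<and> l = A_sum a n u)"

definition W_Ap :: "int \<Rightarrow> int \<Rightarrow> int \<Rightarrow> nat \<Rightarrow> int \<Rightarrow> int" where
  "W_Ap a b m n l = ((a - 1) * m + b) * l + int (m_A a n l) * m"

end

theory Submission
  imports Defs
begin

text \<open>
  Write \<open>d = (a - 1) m + b\<close>. The \<open>i\<close>-th point of the orbit of \<open>m\<close> is \<open>m + d A\<^sub>i\<close>, so \<open>S\<close> consists of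
  the numbers \<open>k m + d x\<close> where \<open>x\<close> is a sum of \<open>k\<close> terms of the sequence \<open>A\<close> (with \<open>A\<^sub>0 = 0\<close>
  allowed as padding). The top canonical digit of \<open>l\<close> is \<open>l div A\<^sub>n\<^sub>-\<^sub>1\<close>; if it is at most the top
  digit of \<open>m - 1\<close> minus two, then \<open>l + A\<^sub>n\<^sub>-\<^sub>1 < m\<close>. The exchange \<open>A\<^sub>i\<^sub>+\<^sub>1 = a A\<^sub>i + 1\<close> shows that adding
  \<open>A\<^sub>n\<^sub>-\<^sub>1\<close> raises the minimal number of summands by exactly one, so
  \<open>W(l + A\<^sub>n\<^sub>-\<^sub>1) - W(l) = m + d A\<^sub>n\<^sub>-\<^sub>1\<close> is a generator of \<open>S\<close>. Finally \<open>d \<ge> m - 2\<close> forces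
  \<open>W(l + A\<^sub>n\<^sub>-\<^sub>1)\<close> into the Apery set.
\<close>

section \<open>Recursion and growth of the sequence \<open>A_seq\<close>\<close>

lemma A_seq_0 [simp]: "A_seq a 0 = 0"
  by (simp add: A_seq_def)

lemma A_seq_Suc:
  assumes "a \<ge> 2"
  shows "A_seq a (Suc i) = a * A_seq a i + 1"
proof -
  have "a - 1 dvd a ^ i - 1"
    by (metis dvd_triv_left power_diff_1_eq)
  then have "a ^ i = (a - 1) * A_seq a i + 1"
    by (simp add: A_seq_def)
  then have "a ^ Suc i - 1 = (a * A_seq a i + 1) * (a - 1)"
    unfolding power_Suc by (simp only:) (simp add: algebra_simps)
  with assms show ?thesis
    by (simp add: A_seq_def)
qed

lemma A_seq_ge:
  assumes "a \<ge> 2"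
  shows "int i \<le> A_seq a i"
proof (induction i)
  case (Suc i)
  then have "1 * A_seq a i \<le> a * A_seq a i"
    using assms by (intro mult_right_mono) auto
  with Suc show ?case
    by (simp add: A_seq_Suc[OF assms])
qed simp

lemma A_seq_nonneg: "a \<ge> 2 \<Longrightarrow> 0 \<le> A_seq a i"
  using A_seq_ge[of a i] by simp

lemma A_seq_mono:
  assumes "a \<ge> 2" "i \<le> j"
  shows "A_seq a i \<le> A_seq a j"
  using assms(2)
proof (induction j rule: dec_induct)
  case (step j)
  have "1 * A_seq a j \<le> a * A_seq a j"
    using assms(1) A_seq_nonneg[OF assms(1)] by (intro mult_right_mono) auto
  with step show ?case
    by (simp add: A_seq_Suc[OF assms(1)])
qed simp

section \<open>Sums of terms with a counted number of summands\<close>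

text \<open>When \<open>0 \<in> I\<close> this means at most \<open>s\<close> nonzero terms, because \<open>A\<^sub>0 = 0\<close>.\<close>

inductive A_rep :: "int \<Rightarrow> nat set \<Rightarrow> int \<Rightarrow> nat \<Rightarrow> bool" for a I where
  zero: "A_rep a I 0 0"
| step: "A_rep a I x s \<Longrightarrow> i \<in> I \<Longrightarrow> A_rep a I (x + A_seq a i) (Suc s)"

lemma A_rep_nonneg: "A_rep a I x s \<Longrightarrow> a \<ge> 2 \<Longrightarrow> 0 \<le> x"
  by (induction rule: A_rep.induct) (auto simp: A_seq_nonneg)

lemma A_rep_mono: "A_rep a I x s \<Longrightarrow> I \<subseteq> J \<Longrightarrow> A_rep a J x s"
  by (induction rule: A_rep.induct) (auto intro: A_rep.intros)

lemma A_rep_add: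
  assumes "A_rep a I x s" "A_rep a I y t"
  shows "A_rep a I (x + y) (s + t)"
  using assms(2)
  by (induction rule: A_rep.induct)
    (use assms(1) A_rep.step[of a I] in \<open>auto simp: add.assoc[symmetric]\<close>)

lemma A_rep_mult: "i \<in> I \<Longrightarrow> A_rep a I (int c * A_seq a i) c"
proof (induction c)
  case (Suc c)
  then show ?case
    using A_rep.step[of a I "int c * A_seq a i" c i] by (simp add: algebra_simps)
qed (simp add: A_rep.zero)

lemma A_rep_pad: "A_rep a I x s \<Longrightarrow> 0 \<in> I \<Longrightarrow> s \<le> t \<Longrightarrow> A_rep a I x t"
  using A_rep_add[of a I x s 0 "t - s"] A_rep_mult[of 0 I a "t - s"] by simp

lemma A_rep_0_iff [simp]: "A_rep a I x 0 \<longleftrightarrow> x = 0"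
  by (auto elim: A_rep.cases intro: A_rep.zero)

text \<open>Terms are nonnegative and \<open>A_seq\<close> is monotone, so one term of index
  \<open>n\<close> or more would already push the sum up to \<open>A_seq a n\<close>. This makes
  sums with unrestricted indices, as they occur in \<open>S_ab\<close>, comparable with
  \<open>m_A\<close>.\<close>

lemma A_rep_atMost:
  assumes "A_rep a I x s" "a \<ge> 2" "x < A_seq a n" "n > 0"
  shows "A_rep a {..n - 1} x s"
  using assms(1,3)
proof (induction rule: A_rep.induct)
  case (step x s i)
  have "0 \<le> x" "0 \<le> A_seq a i"
    using step.hyps assms(2) by (auto intro: A_rep_nonneg A_seq_nonneg)
  then have "A_seq a i < A_seq a n" "x < A_seq a n"
    using step.prems by auto
  then have "i < n"
    using A_seq_mono[OF assms(2), of n i] by (meson not_le)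
  then show ?case
    using step.IH \<open>x < A_seq a n\<close> by (auto intro: A_rep.step)
qed (rule A_rep.zero)

section \<open>Exchange and removal of the largest term\<close>

text \<open>A derivation fixes an order of the summands; a use of the top index, if there is one,
  can be moved to the end and stripped off.\<close>

lemma A_rep_atMost_Suc_cases:
  assumes "A_rep a {..Suc k} x s"
  shows "A_rep a {..k} x s \<or> (\<exists>t. s = Suc t \<and> A_rep a {..Suc k} (x - A_seq a (Suc k)) t)"
  using assms
proof (induction rule: A_rep.induct)
  case (step x s i)
  show ?case
  proof (cases "i = Suc k")
    case True
    with step.hyps show ?thesis by auto
  next
    case False
    then have i: "i \<in> {..k}" "i \<in> {..Suc k}"
      using step.hyps by auto
    from step.IH show ?thesis
    proof
      assume "A_rep a {..k} x s"
      with i show ?thesis by (auto intro: A_rep.step)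
    next
      assume "\<exists>t. s = Suc t \<and> A_rep a {..Suc k} (x - A_seq a (Suc k)) t"
      then obtain t where "s = Suc t" "A_rep a {..Suc k} (x - A_seq a (Suc k)) t" by blast
      then show ?thesis
        using A_rep.step[OF _ i(2), of a "x - A_seq a (Suc k)" t] by (simp add: algebra_simps)
    qed
  qed
qed (simp add: A_rep.zero)

text \<open>A used \<open>A\<^sub>i\<^sub>+\<^sub>1\<close> is replaced by \<open>a\<close> copies of \<open>A\<^sub>i\<close>.\<close>

lemma A_rep_decrement:
  assumes "A_rep a {..k} y t" "a \<ge> 2" "y \<ge> 1"
  shows "t \<ge> 1 \<and> A_rep a {..k} (y - 1) (t - 1 + nat a)"
  using assms(1,3)
proof (induction rule: A_rep.induct)
  case (step x s i)
  show ?case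
  proof (cases i)
    case 0
    then have "s \<ge> 1" "A_rep a {..k} (x - 1) (s - 1 + nat a)"
      using step by auto
    \<comment> \<open>The new term is \<open>A_seq a 0 = 0\<close>, so the induction hypothesis
      yields one summand fewer than required; padding supplies it.\<close>
    then show ?thesis
      using A_rep_pad[of a "{..k}" "x - 1" "s - 1 + nat a" "s + nat a"] 0 by simp
  next
    case (Suc j)
    then have "j \<in> {..k}" using step.hyps by simp
    then have "A_rep a {..k} (a * A_seq a j) (nat a)"
      using A_rep_mult[of j "{..k}" a "nat a"] assms(2) by simp
    with step.hyps(1) have "A_rep a {..k} (x + a * A_seq a j) (s + nat a)"
      by (rule A_rep_add)
    then show ?thesis
      using Suc by (simp add: A_seq_Suc[OF assms(2)])
  qed
qed simp

lemma A_rep_remove_top: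
  assumes "A_rep a {..k} x s" "a \<ge> 2" "k \<ge> 1" "A_seq a k \<le> x"
  shows "\<exists>t. s = Suc t \<and> A_rep a {..k} (x - A_seq a k) t"
  using assms(3,1,4)
proof (induction k arbitrary: x s rule: dec_induct)
  case base
  \<comment> \<open>Index 0 alone produces only the sum 0, whereas \<open>x\<close> is at least
    \<open>A_seq a 1 = 1\<close>.\<close>
  have "\<not> A_rep a {..0} x s"
  proof
    assume "A_rep a {..0} x s"
    then have "x = 0"
      by (induction rule: A_rep.induct) auto
    with base show False
      by (simp add: A_seq_Suc[OF assms(2)])
  qed
  with A_rep_atMost_Suc_cases[of a 0 x s] base show ?case by simp
next
  case (step k)
  consider "A_rep a {..k} x s" |
    "\<exists>t. s = Suc t \<and> A_rep a {..Suc k} (x - A_seq a (Suc k)) t"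
    using A_rep_atMost_Suc_cases step.prems(1) by blast
  then show ?case
  proof cases
    case 1
    have A: "A_seq a k \<ge> 0" by (rule A_seq_nonneg[OF assms(2)])
    \<comment> \<open>The copies are stripped one at a time; before each removal the remainder is
      still at least \<open>A_seq a k\<close>.\<close>
    have "c \<le> nat a \<Longrightarrow> c \<le> s \<and> A_rep a {..k} (x - int c * A_seq a k) (s - c)" for c
    proof (induction c)
      case (Suc c)
      have "int (Suc c) * A_seq a k \<le> a * A_seq a k"
        using Suc.prems A by (intro mult_right_mono) auto
      then have "A_seq a k \<le> x - int c * A_seq a k"
        using step.prems(2) by (simp add: A_seq_Suc[OF assms(2)] algebra_simps)
      then obtain t where "s - c = Suc t" "A_rep a {..k} (x - int c * A_seq a k - A_seq a k) t"
        using step.IH Suc by (metis Suc_leD)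
      then show ?case
        by (auto simp: algebra_simps dest: sym[of "_ - _"] intro: Suc_leI)
          (metis Suc_diff_Suc diff_Suc_1 zero_less_Suc zero_less_diff)
    qed (use 1 in simp)
    from this[of "nat a"] have *: "nat a \<le> s" "A_rep a {..k} (x - a * A_seq a k) (s - nat a)"
      using assms(2) by auto
    moreover have "x - a * A_seq a k \<ge> 1"
      using step.prems(2) by (simp add: A_seq_Suc[OF assms(2)])
    ultimately have "s - nat a \<ge> 1"
      "A_rep a {..k} (x - a * A_seq a k - 1) (s - nat a - 1 + nat a)"
      using A_rep_decrement assms(2) by blast+
    then have "s = Suc (s - 1)" "A_rep a {..k} (x - A_seq a (Suc k)) (s - 1)"
      using *(1) by (auto simp: A_seq_Suc[OF assms(2)] algebra_simps)
    then show ?thesis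
      using A_rep_mono[of a "{..k}" _ _ "{..Suc k}"] by auto
  qed simp
qed

section \<open>Minimal length \<open>m_A\<close> in terms of \<open>A_rep\<close>\<close>

lemma A_rep_of_sum:
  assumes "k \<le> N"
  shows "A_rep a {..N} (\<Sum>i=1..k. int (u i) * A_seq a i) (\<Sum>i=1..k. u i)"
  using assms
proof (induction k)
  case (Suc k)
  then show ?case
    using A_rep_add[OF _ A_rep_mult[of "Suc k" "{..N}" a "u (Suc k)"]] by simp
qed (simp add: A_rep.zero)

text \<open>Only an inequality holds for the length: uses of index 0 count in \<open>s\<close> but
  have no place in a tuple.\<close>

lemma tuples_of_A_rep:
  assumes "A_rep a {..n - 1} x s"
  shows "\<exists>u\<in>tuples n. x = A_sum a n u \<and> (\<Sum>i=1..n-1. u i) \<le> s"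
  using assms
proof (induction rule: A_rep.induct)
  case zero
  then show ?case
    by (intro bexI[of _ "\<lambda>i\<in>{1..n-1}. 0"]) (auto simp: A_sum_def tuples_def)
next
  case (step x s i)
  then obtain u where u: "u \<in> tuples n" "x = A_sum a n u" "(\<Sum>i=1..n-1. u i) \<le> s"
    by blast
  show ?case
  proof (cases "i = 0")
    case True
    with u show ?thesis by auto
  next
    case False
    then have i: "i \<in> {1..n-1}" using step.hyps by auto
    define v where "v = u(i := Suc (u i))"
    have "v \<in> tuples n"
      using u(1) i by (auto simp: v_def tuples_def PiE_def extensional_def)
    moreover have "A_sum a n v = x + A_seq a i"
    proof -
      have "A_sum a n v = (\<Sum>j=1..n-1. int (u j) * A_seq a j + (if j = i then A_seq a i else 0))"
        unfolding A_sum_def v_def by (rule sum.cong) (auto simp: algebra_simps)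
      with i show ?thesis by (simp add: A_sum_def u(2) sum.distrib)
    qed
    moreover have "(\<Sum>i=1..n-1. v i) = Suc (\<Sum>i=1..n-1. u i)"
    proof -
      have "(\<Sum>j=1..n-1. v j) = (\<Sum>j=1..n-1. u j + (if j = i then 1 else 0))"
        unfolding v_def by (rule sum.cong) auto
      with i show ?thesis by (simp add: sum.distrib)
    qed
    ultimately show ?thesis
      using u(3) by (intro bexI[of _ v]) auto
  qed
qed

lemma m_A_le:
  assumes "A_rep a {..n - 1} x s"
  shows "m_A a n x \<le> s"
proof -
  obtain u where "u \<in> tuples n" "x = A_sum a n u" "(\<Sum>i=1..n-1. u i) \<le> s"
    using tuples_of_A_rep[OF assms] by blast
  then show ?thesis
    unfolding m_A_def by (intro order_trans[OF Least_le]) auto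
qed

text \<open>Since \<open>A_seq a 1 = 1\<close>, every nonnegative number is a sum of ones. Hence the
  minimum in \<open>m_A\<close> is attained, and it is at most \<open>x\<close>.\<close>

lemma A_rep_all_ones:
  assumes "a \<ge> 2" "n \<ge> 2" "x \<ge> 0"
  shows "A_rep a {..n - 1} x (nat x)"
  using A_rep_mult[of 1 "{..n - 1}" a "nat x"] assms A_seq_Suc[of a 0] by simp

lemma A_rep_m_A:
  assumes "a \<ge> 2" "n \<ge> 2" "x \<ge> 0"
  shows "A_rep a {..n - 1} x (m_A a n x)"
proof -
  have "\<exists>k. \<exists>u\<in>tuples n. x = A_sum a n u \<and> k = (\<Sum>i=1..n-1. u i)"
    using tuples_of_A_rep[OF A_rep_all_ones[OF assms]] by blast
  from LeastI_ex[OF this] obtain u where "x = A_sum a n u" "m_A a n x = (\<Sum>i=1..n-1. u i)"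
    unfolding m_A_def[symmetric] by blast
  then show ?thesis
    using A_rep_of_sum[of "n - 1" "n - 1" a u] by (simp add: A_sum_def)
qed

section \<open>Elements of the semigroup\<close>

lemma funpow_T_ab:
  assumes "a \<ge> 2"
  shows "(T_ab a b ^^ i) m = m + ((a - 1) * m + b) * A_seq a i"
proof (induction i)
  case (Suc i)
  have "(T_ab a b ^^ Suc i) m = a * (T_ab a b ^^ i) m + b"
    by (simp add: T_ab_def)
  then show ?case
    unfolding Suc.IH by (simp add: A_seq_Suc[OF assms] algebra_simps)
qed simp

text \<open>Here \<open>k\<close> counts the generators used. Index 0 stands for the generator
  \<open>m\<close> itself, so every index is allowed and the count is exact.\<close>

lemma mem_S_ab_iff:
  assumes "a \<ge> 2"
  shows "x \<in> S_ab a b m \<longleftrightarrow>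
    (\<exists>k y. A_rep a UNIV y k \<and> x = int k * m + ((a - 1) * m + b) * y)"
proof
  assume "x \<in> S_ab a b m"
  then show "\<exists>k y. A_rep a UNIV y k \<and> x = int k * m + ((a - 1) * m + b) * y"
    unfolding S_ab_def
  proof (induction rule: submonoid_gen.induct)
    case zero
    show ?case by (intro exI[of _ 0]) simp
  next
    case (gen x)
    then obtain i where "x = m + ((a - 1) * m + b) * A_seq a i"
      by (auto simp: funpow_T_ab[OF assms])
    then show ?case
      using A_rep_mult[of i UNIV a 1] by (intro exI[of _ 1] exI[of _ "A_seq a i"]) simp
  next
    case (add x x')
    then obtain k y k' y' where "A_rep a UNIV y k" "x = int k * m + ((a - 1) * m + b) * y"
      "A_rep a UNIV y' k'" "x' = int k' * m + ((a - 1) * m + b) * y'"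
      by blast
    then show ?case
      by (intro exI[of _ "k + k'"] exI[of _ "y + y'"]) (simp add: A_rep_add algebra_simps)
  qed
next
  assume "\<exists>k y. A_rep a UNIV y k \<and> x = int k * m + ((a - 1) * m + b) * y"
  then obtain k y where rep: "A_rep a UNIV y k" and x: "x = int k * m + ((a - 1) * m + b) * y"
    by blast
  from rep have "int k * m + ((a - 1) * m + b) * y \<in> S_ab a b m"
    unfolding S_ab_def
  proof (induction rule: A_rep.induct)
    case zero
    show ?case by (simp add: submonoid_gen.zero)
  next
    case (step y k i)
    let ?X = "{(T_ab a b ^^ i) m | i. True}"
    have "(T_ab a b ^^ i) m \<in> submonoid_gen ?X"
      by (rule submonoid_gen.gen) blast
    with step.IH have "(int k * m + ((a - 1) * m + b) * y) + (T_ab a b ^^ i) m \<in> submonoid_gen ?X"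
      by (rule submonoid_gen.add)
    also have "(int k * m + ((a - 1) * m + b) * y) + (T_ab a b ^^ i) m
      = int (Suc k) * m + ((a - 1) * m + b) * (y + A_seq a i)"
      by (simp add: funpow_T_ab[OF assms] algebra_simps)
    finally show ?case .
  qed
  with x show "x \<in> S_ab a b m" by simp
qed

section \<open>Membership in the Apery set\<close>

lemma W_Ap_mem_Ap:
  assumes "a \<ge> 2" "m > 1" "gcd b m = 1" "b \<ge> - (a - 2) * m - 2"
    and "n \<ge> 2" "A_seq a n \<ge> m" "0 \<le> l" "l < m"
  shows "W_Ap a b m n l \<in> Ap (S_ab a b m) m"
proof -
  define d where "d = (a - 1) * m + b"
  \<comment> \<open>This is the hypothesis on \<open>b\<close> rewritten in terms of
    \<open>d\<close>; with \<open>m > 1\<close> it also gives \<open>d \<ge> 0\<close>.\<close>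
  have d: "d \<ge> m - 2"
    using assms(4) by (simp add: d_def algebra_simps)
  have "A_rep a UNIV l (m_A a n l)"
    using A_rep_m_A A_rep_mono assms by blast
  then have "W_Ap a b m n l \<in> S_ab a b m"
    unfolding mem_S_ab_iff[OF assms(1)] W_Ap_def by (metis add.commute)
  moreover have "W_Ap a b m n l - m \<notin> S_ab a b m"
  proof
    assume "W_Ap a b m n l - m \<in> S_ab a b m"
    then obtain k y where y: "A_rep a UNIV y k" and
      "d * l + int (m_A a n l) * m - m = int k * m + d * y"
      unfolding mem_S_ab_iff[OF assms(1)] W_Ap_def d_def by blast
    then have eq: "d * (y - l) = m * (int (m_A a n l) - 1 - int k)"
      by (simp add: algebra_simps)
    \<comment> \<open>Modulo \<open>m\<close>, \<open>d\<close> is congruent to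
      \<open>b\<close>.\<close>
    have "coprime m d"
      using assms(3) unfolding d_def coprime_iff_gcd_eq_1
      by (metis add.commute gcd.commute gcd_add_mult mult.commute)
    moreover have "m dvd d * (y - l)"
      by (simp add: eq)
    ultimately have "m dvd y - l"
      by (simp add: coprime_dvd_mult_right_iff)
    then obtain q where q: "y = l + m * q"
      by (metis dvdE add.commute diff_add_cancel)
    have "0 \<le> y"
      using y assms(1) by (rule A_rep_nonneg)
    have "q \<ge> 0"
    proof (rule ccontr)
      assume "\<not> q \<ge> 0"
      then have "m * q \<le> m * (-1)"
        using assms(2) by (intro mult_left_mono) auto
      with \<open>0 \<le> y\<close> q assms show False by simp
    qed
    have kq: "int k + d * q = int (m_A a n l) - 1"
    proof -
      have "m * (d * q) = m * (int (m_A a n l) - 1 - int k)"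
        using eq q by (simp add: algebra_simps)
      then show ?thesis using assms(2) by simp
    qed
    show False
    proof (cases "q = 0")
      case True
      \<comment> \<open>Now \<open>y = l < A_seq a n\<close>, so this is an admissible
        representation of \<open>l\<close> with fewer than \<open>m_A a n l\<close>
        summands.\<close>
      then have "A_rep a {..n - 1} l k"
        using A_rep_atMost[OF y assms(1), of n] q assms by simp
      then have "m_A a n l \<le> k"
        by (rule m_A_le)
      with kq True show False by simp
    next
      case False
      \<comment> \<open>From \<open>m_A a n l \<le> l \<le> m - 1\<close> and
        \<open>d * q \<ge> d \<ge> m - 2\<close>, the equation \<open>kq\<close> leaves
        \<open>k \<le> 0\<close>. A sum without summands is 0, but \<open>y = l + m * q\<close> is
        positive.\<close>
      have "int (m_A a n l) \<le> l"
        using m_A_le[OF A_rep_all_ones] assms by (metis int_nat_eq nat_int_comparison(3))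
      moreover have "d * 1 \<le> d * q"
        using False \<open>q \<ge> 0\<close> d assms(2) by (intro mult_left_mono) auto
      ultimately have "k = 0"
        using kq d assms(8) by linarith
      then have "y = 0" using y by simp
      moreover have "m * q > 0"
        using False \<open>q \<ge> 0\<close> assms(2) by simp
      ultimately show False using q assms(7) by simp
    qed
  qed
  ultimately show ?thesis by (simp add: Ap_def)
qed

section \<open>Canonical representatives and their top digit\<close>

lemma A_sum_Suc_Suc:
  "A_sum a (Suc (Suc k)) u = A_sum a (Suc k) u + int (u (Suc k)) * A_seq a (Suc k)"
  by (simp add: A_sum_def)

lemma A_sum_cong:
  "(\<And>i. i \<in> {1..n-1} \<Longrightarrow> u i = v i) \<Longrightarrow> A_sum a n u = A_sum a n v"
  by (simp add: A_sum_def)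

lemma R_set_restrict:
  "u \<in> R_set a (Suc (Suc k)) \<Longrightarrow> restrict u {1..k} \<in> R_set a (Suc k)"
  by (auto simp: R_set_def tuples_def)

text \<open>A top digit \<open>a\<close> forces zeros below, giving \<open>a * A_seq a k\<close>,
  one less than \<open>A_seq a (Suc k)\<close>. With a top digit at most \<open>a - 1\<close>, the
  inductive bound on the lower digits suffices.\<close>

lemma R_set_A_sum_bounds:
  assumes "a \<ge> 2" "u \<in> R_set a (Suc k)"
  shows "0 \<le> A_sum a (Suc k) u \<and> A_sum a (Suc k) u < A_seq a (Suc k)"
  using assms(2)
proof (induction k arbitrary: u)
  case 0
  then show ?case by (simp add: A_sum_def A_seq_Suc[OF assms(1)])
next
  case (Suc k)
  have A: "A_seq a (Suc k) \<ge> 0" by (rule A_seq_nonneg[OF assms(1)])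
  have eq: "A_sum a (Suc k) (restrict u {1..k}) = A_sum a (Suc k) u"
    by (rule A_sum_cong) simp
  have IH: "0 \<le> A_sum a (Suc k) u" "A_sum a (Suc k) u < A_seq a (Suc k)"
    using Suc.IH[OF R_set_restrict[OF Suc.prems]] unfolding eq by auto
  show ?case
  proof (cases "int (u (Suc k)) = a")
    case True
    then have "\<And>j. j \<in> {1..k} \<Longrightarrow> u j = 0"
      using Suc.prems by (auto simp: R_set_def)
    then have "A_sum a (Suc k) u = 0"
      by (simp add: A_sum_def)
    with True A assms(1) show ?thesis
      by (simp add: A_sum_Suc_Suc A_seq_Suc[OF assms(1), of "Suc k"])
  next
    case False
    moreover have "int (u (Suc k)) \<le> a"
      using Suc.prems by (simp add: R_set_def)
    ultimately have "int (u (Suc k)) \<le> a - 1" by simp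
    then have "int (u (Suc k)) * A_seq a (Suc k) \<le> (a - 1) * A_seq a (Suc k)"
      using A by (rule mult_right_mono)
    with IH A show ?thesis
      by (simp add: A_sum_Suc_Suc A_seq_Suc[OF assms(1), of "Suc k"] algebra_simps)
  qed
qed

text \<open>The lower digits sum to less than \<open>A_seq a (Suc k)\<close>, so splitting off the
  top digit is Euclidean division.\<close>

lemma R_set_top_digit:
  assumes "a \<ge> 2" "u \<in> R_set a (Suc (Suc k))"
  shows "int (u (Suc k)) = A_sum a (Suc (Suc k)) u div A_seq a (Suc k)"
    and "A_sum a (Suc k) (restrict u {1..k}) = A_sum a (Suc (Suc k)) u mod A_seq a (Suc k)"
proof -
  have eq: "A_sum a (Suc k) (restrict u {1..k}) = A_sum a (Suc k) u"
    by (rule A_sum_cong) simp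
  have "0 \<le> A_sum a (Suc k) u" "A_sum a (Suc k) u < A_seq a (Suc k)"
    using R_set_A_sum_bounds[OF assms(1) R_set_restrict[OF assms(2)]] unfolding eq by auto
  then show "int (u (Suc k)) = A_sum a (Suc (Suc k)) u div A_seq a (Suc k)"
    and "A_sum a (Suc k) (restrict u {1..k}) = A_sum a (Suc (Suc k)) u mod A_seq a (Suc k)"
    unfolding A_sum_Suc_Suc eq by auto
qed

lemma R_set_A_sum_inj:
  assumes "a \<ge> 2" "u \<in> R_set a (Suc k)" "v \<in> R_set a (Suc k)"
    and "A_sum a (Suc k) u = A_sum a (Suc k) v"
  shows "u = v"
  using assms(2-)
proof (induction k arbitrary: u v)
  case 0
  then show ?case by (simp add: R_set_def tuples_def)
next
  case (Suc k)
  have "restrict u {1..k} = restrict v {1..k}"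
    using Suc R_set_top_digit(2)[OF assms(1)] R_set_restrict by metis
  then have low: "\<And>i. i \<in> {1..k} \<Longrightarrow> u i = v i"
    by (metis restrict_apply')
  have "int (u (Suc k)) = int (v (Suc k))"
    using Suc.prems R_set_top_digit(1)[OF assms(1)] by metis
  then have eq: "u i = v i" if "i \<in> {1..Suc k}" for i
    using low that by (metis atLeastAtMost_iff le_Suc_eq of_nat_eq_iff)
  have "u \<in> extensional {1..Suc k}" "v \<in> extensional {1..Suc k}"
    using Suc.prems by (auto simp: R_set_def tuples_def PiE_def)
  then show ?case using eq by (rule extensionalityI)
qed

text \<open>Greedy expansion: the top digit is the quotient by the largest term, and the remainder
  is expanded recursively.\<close>

lemma R_set_exists:
  assumes "a \<ge> 2" "0 \<le> l" "l < A_seq a (Suc k)"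
  shows "\<exists>u\<in>R_set a (Suc k). l = A_sum a (Suc k) u"
  using assms(2-)
proof (induction k arbitrary: l)
  case 0
  then show ?case
    by (auto simp: A_seq_Suc[OF assms(1)] R_set_def tuples_def A_sum_def)
next
  case (Suc k)
  define A where "A = A_seq a (Suc k)"
  define q where "q = l div A"
  have A: "A \<ge> 1"
    using A_seq_ge[OF assms(1), of "Suc k"] by (simp add: A_def)
  have l: "l \<le> a * A"
    using Suc.prems(2) by (simp add: A_def A_seq_Suc[OF assms(1), of "Suc k"])
  have q: "0 \<le> q"
    using A Suc.prems(1) by (simp add: q_def pos_imp_zdiv_nonneg_iff)
  have "q \<le> (a * A) div A"
    unfolding q_def using l A by (intro zdiv_mono1) auto
  then have "q \<le> a" using A by simp
  obtain v where v: "v \<in> R_set a (Suc k)" "l mod A = A_sum a (Suc k) v"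
    using Suc.IH[of "l mod A"] A by (auto simp: A_def)
  define u where "u = v(Suc k := nat q)"
  have "A_sum a (Suc k) u = A_sum a (Suc k) v"
    by (rule A_sum_cong) (simp add: u_def)
  moreover have "int (u (Suc k)) = q"
    using q by (simp add: u_def)
  moreover have "q * A + l mod A = l"
    unfolding q_def by (rule div_mult_mod_eq)
  ultimately have sum: "l = A_sum a (Suc (Suc k)) u"
    unfolding A_sum_Suc_Suc using v(2) A_def by simp
  \<comment> \<open>A quotient \<open>a\<close> together with \<open>l \<le> a * A\<close> leaves
    remainder 0, and all terms with positive index are positive.\<close>
  have v0: "v j = 0" if "q = a" "j \<in> {1..k}" for j
  proof -
    have "l mod A = l - q * A"
      unfolding q_def by (rule minus_div_mult_eq_mod[symmetric])
    then have "l mod A \<le> 0"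
      using l that(1) by simp
    then have "A_sum a (Suc k) v = 0"
      using A v(2) pos_mod_sign[of A l] by linarith
    then have "\<forall>i\<in>{1..k}. int (v i) * A_seq a i = 0"
      using A_seq_nonneg[OF assms(1)]
      by (subst (asm) A_sum_def, subst (asm) sum_nonneg_eq_0_iff) auto
    then have "int (v j) * A_seq a j = 0"
      using that(2) by blast
    then show "v j = 0"
      using that(2) A_seq_ge[OF assms(1), of j] by auto
  qed
  have "u \<in> R_set a (Suc (Suc k))"
  proof -
    have "v \<in> tuples (Suc k)"
      using v(1) unfolding R_set_def by blast
    then have v_ext: "v \<in> extensional {1..k}"
      by (simp add: tuples_def PiE_def)
    have u_undef: "u i = undefined" if "i \<notin> {1..Suc k}" for i
    proof -
      have "i \<noteq> Suc k" "i \<notin> {1..k}"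
        using that by auto
      then show ?thesis
        using extensional_arb[OF v_ext] by (simp add: u_def)
    qed
    have "u \<in> tuples (Suc (Suc k))"
      unfolding tuples_def diff_Suc_1 by (rule PiE_I[OF UNIV_I u_undef])
    moreover have "int (u j) \<le> a \<and> (int (u j) = a \<longrightarrow> (\<forall>i\<in>{1..Suc k}. i < j \<longrightarrow> u i = 0))"
      if "j \<in> {1..Suc k}" for j
    proof (cases "j = Suc k")
      case True
      then show ?thesis using q \<open>q \<le> a\<close> v0 by (simp add: u_def)
    next
      case False
      with that have "j \<in> {1..k}" by auto
      moreover from this have "int (v j) \<le> a"
        "int (v j) = a \<longrightarrow> (\<forall>i\<in>{1..k}. i < j \<longrightarrow> v i = 0)"
        using v(1) unfolding R_set_def diff_Suc_1 by blast+
      ultimately show ?thesis by (auto simp: u_def)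
    qed
    ultimately show ?thesis
      unfolding R_set_def diff_Suc_1 by blast
  qed
  with sum show ?case by (rule bexI)
qed

lemma canonical_rep_top_digit:
  assumes "a \<ge> 2" "n \<ge> 2" "0 \<le> l" "l < A_seq a n"
  shows "int (canonical_rep a n l (n - 1)) = l div A_seq a (n - 1)"
proof -
  obtain k where n: "n = Suc (Suc k)"
    using assms(2) by (metis Suc_le_D numeral_2_eq_2 Suc_le_mono)
  have "\<exists>!u. u \<in> R_set a n \<and> l = A_sum a n u"
    using R_set_exists[of a l "Suc k"] R_set_A_sum_inj[of a _ "Suc k"] assms n by metis
  then have "canonical_rep a n l \<in> R_set a n \<and> l = A_sum a n (canonical_rep a n l)"
    unfolding canonical_rep_def by (rule theI')
  then show ?thesis
    using R_set_top_digit(1)[OF assms(1), of "canonical_rep a n l" k] n by simp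
qed

section \<open>Adding the largest term and non-maximality\<close>

text \<open>Appending the term gives the upper bound; removing it from a shortest representation, by
  \<open>A_rep_remove_top\<close>, gives the lower one.\<close>

lemma m_A_add_top:
  assumes "a \<ge> 2" "n \<ge> 2" "0 \<le> l"
  shows "m_A a n (l + A_seq a (n - 1)) = Suc (m_A a n l)"
proof (rule antisym)
  show "m_A a n (l + A_seq a (n - 1)) \<le> Suc (m_A a n l)"
    using A_rep_m_A[OF assms] by (intro m_A_le A_rep.step) auto
next
  have nonneg: "0 \<le> l + A_seq a (n - 1)"
    using assms A_seq_nonneg[of a "n - 1"] by simp
  obtain t where "m_A a n (l + A_seq a (n - 1)) = Suc t" "A_rep a {..n - 1} l t"
    using A_rep_remove_top[OF A_rep_m_A[OF assms(1,2) nonneg] assms(1)] assms(2,3)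
    by (auto simp: le_diff_conv2)
  then show "Suc (m_A a n l) \<le> m_A a n (l + A_seq a (n - 1))"
    using m_A_le by auto
qed

theorem corollary5p8:
  fixes a b m l :: int and n :: nat
  assumes "a \<ge> 2" and "m > 1" and "gcd b m = 1" and "b \<ge> - (a - 2) * m - 2"
    and "n = (LEAST k. 0 < k \<and> A_seq a k \<ge> m)"
    and "l \<in> {0..m - 1}"
  shows "(W_Ap a b m n l \<in> Maximals (preceq (S_ab a b m)) (Ap (S_ab a b m) m) \<longrightarrow>
            int (canonical_rep a n l (n - 1)) \<in>
              {int (canonical_rep a n (m - 1) (n - 1)) - 1, int (canonical_rep a n (m - 1) (n - 1))})
       \<and> (int (canonical_rep a n l (n - 1)) \<le> int (canonical_rep a n (m - 1) (n - 1)) - 2 \<longrightarrow>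
            W_Ap a b m n l \<notin> Maximals (preceq (S_ab a b m)) (Ap (S_ab a b m) m))"
proof -
  define A where "A = A_seq a (n - 1)"
  \<comment> \<open>Because \<open>A_seq a i \<ge> i\<close>, the index \<open>nat m\<close> shows
    that the least index \<open>n\<close> exists.\<close>
  have "0 < nat m \<and> A_seq a (nat m) \<ge> m"
    using A_seq_ge[OF assms(1), of "nat m"] assms(2) by simp
  then have n: "0 < n" "A_seq a n \<ge> m"
    unfolding assms(5) by (rule LeastI2; simp)+
  have "n \<noteq> 1"
    using n(2) assms(1,2) A_seq_Suc[of a 0] by auto
  with n(1) have n2: "n \<ge> 2" by simp
  then have A1: "A \<ge> 1"
    using A_seq_ge[OF assms(1), of "n - 1"] by (simp add: A_def)
  have top: "int (canonical_rep a n x (n - 1)) = x div A" if "0 \<le> x" "x \<le> m - 1" for x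
    using canonical_rep_top_digit[OF assms(1) n2 that(1)] that n(2) by (simp add: A_def)
  have not_max: "W_Ap a b m n l \<notin> Maximals (preceq (S_ab a b m)) (Ap (S_ab a b m) m)"
    if "l div A \<le> (m - 1) div A - 2"
  proof -
    \<comment> \<open>As \<open>l < A * (l div A + 1)\<close>, one more \<open>A\<close> stays below
      \<open>A * (l div A + 2)\<close>, hence below \<open>m\<close>.\<close>
    have "A * (l div A + 2) \<le> A * ((m - 1) div A)"
      using that A1 by (intro mult_left_mono) auto
    moreover have "l mod A < A" "0 \<le> (m - 1) mod A"
      using A1 by auto
    ultimately have "l + A < m"
      using mult_div_mod_eq[of A l] mult_div_mod_eq[of A "m - 1"]
      unfolding distrib_left by linarith
    then have in_Ap: "W_Ap a b m n (l + A) \<in> Ap (S_ab a b m) m"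
      using assms A1 n2 n(2) by (intro W_Ap_mem_Ap) auto
    have diff: "W_Ap a b m n (l + A) - W_Ap a b m n l = m + ((a - 1) * m + b) * A"
      using m_A_add_top[OF assms(1) n2, of l] assms(6)
      by (simp add: W_Ap_def A_def algebra_simps)
    \<comment> \<open>The difference is the single generator \<open>(T_ab a b ^^ (n - 1)) m\<close>,
      hence the witnesses 1 and \<open>A\<close>.\<close>
    have "preceq (S_ab a b m) (W_Ap a b m n l) (W_Ap a b m n (l + A))"
      unfolding preceq_def diff mem_S_ab_iff[OF assms(1)]
      using A_rep_mult[of "n - 1" UNIV a 1] by (intro exI[of _ 1] exI[of _ A]) (simp add: A_def)
    \<comment> \<open>Nonnegativity makes the difference at least \<open>m > 0\<close>, so the
      larger element is a different one.\<close>
    moreover have "0 \<le> ((a - 1) * m + b) * A"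
      using assms(2,4) A1 by (intro mult_nonneg_nonneg) (simp_all add: algebra_simps)
    then have "W_Ap a b m n (l + A) \<noteq> W_Ap a b m n l"
      using diff assms(2) by linarith
    ultimately show ?thesis
      using in_Ap by (auto simp: Maximals_def)
  qed
  \<comment> \<open>The top digit is monotone in \<open>l\<close>; once a gap of 2 or more is
    excluded, two values remain.\<close>
  have "l div A \<le> (m - 1) div A"
    using assms(6) A1 by (intro zdiv_mono1) auto
  with not_max show ?thesis
    using top[of l] top[of "m - 1"] assms(2,6) by force
qed

end
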